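(* Let $D$ be an integral domain with quotient field $K$ and let $V$ be a minimal valuation overring of $D$. If $\operatorname{Zar}(D)\setminus\{V\}$ is compact, then there are $x_1,\ldots,x_n\in K$ and a maximal ideal $M$ of $D[x_1,\ldots,x_n]$ such that $V$ is the integral closure of the localization $D[x_1,\ldots,x_n]_M$ (in $K$).
   Context: For an integral domain $D$ with quotient field $K$, $\operatorname{Zar}(D)$ is the set of all valuation rings $V$ with $D\subseteq V\subseteq K$ and quotient field $K$ (including $K$ itself), called valuation overrings of $D$. It carries the Zariski topology, having as a subbasis of open sets the sets $\{V\in\operatorname{Zar}(D)\mid x_1,\ldots,x_n\in V\}$ for finite subsets $\{x_1,\ldots,x_n\}\subseteq K$. A minimal valuation overring is a minimal element of $\operatorname{Zar}(D)$ with respect to inclusion. "Compact" means that every open cover has a finite subcover (no Hausdorff condition). *)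

theory Defs
  imports "HOL-Algebra.Algebra" "HOL-Analysis.Abstract_Topology"
begin

text \<open>All rings live inside an ambient field \<open>K\<close>; overrings, localizations and integral closures
  are represented by their carriers, i.e. as subsets of \<open>carrier K\<close>.\<close>

definition has_quotient_field :: "('a, 'b) ring_scheme \<Rightarrow> 'a set \<Rightarrow> bool" where
  "has_quotient_field K D \<longleftrightarrow>
     (\<forall>x \<in> carrier K. \<exists>a \<in> D. \<exists>b \<in> D - {\<zero>\<^bsub>K\<^esub>}. x = a \<otimes>\<^bsub>K\<^esub> inv\<^bsub>K\<^esub> b)"

definition valuation_ring_of :: "('a, 'b) ring_scheme \<Rightarrow> 'a set \<Rightarrow> bool" where
  "valuation_ring_of K V \<longleftrightarrow> subdomain V K \<and> has_quotient_field K V \<and>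
     (\<forall>x \<in> carrier K - {\<zero>\<^bsub>K\<^esub>}. x \<in> V \<or> inv\<^bsub>K\<^esub> x \<in> V)"

definition Zar :: "('a, 'b) ring_scheme \<Rightarrow> 'a set \<Rightarrow> 'a set set" where
  "Zar K D = {V. D \<subseteq> V \<and> valuation_ring_of K V}"

definition zariski_topology :: "('a, 'b) ring_scheme \<Rightarrow> 'a set \<Rightarrow> 'a set topology" where
  "zariski_topology K D =
     topology_generated_by {{V \<in> Zar K D. S \<subseteq> V} |S. finite S \<and> S \<subseteq> carrier K}"

definition minimal_valuation_overring ::
  "('a, 'b) ring_scheme \<Rightarrow> 'a set \<Rightarrow> 'a set \<Rightarrow> bool" where
  "minimal_valuation_overring K D V \<longleftrightarrow>
     V \<in> Zar K D \<and> (\<forall>W \<in> Zar K D. W \<subseteq> V \<longrightarrow> W = V)"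

definition adjoin :: "('a, 'b) ring_scheme \<Rightarrow> 'a set \<Rightarrow> 'a set \<Rightarrow> 'a set" where
  "adjoin K D S = generate_ring K (D \<union> S)"

text \<open>The localization of a subring \<open>A\<close> of \<open>K\<close> at a prime ideal \<open>P\<close>. For prime \<open>P\<close> the
  denominators are automatically nonzero, since \<open>\<zero> \<in> P\<close>.\<close>

definition localization_at :: "('a, 'b) ring_scheme \<Rightarrow> 'a set \<Rightarrow> 'a set \<Rightarrow> 'a set" where
  "localization_at K A P = {a \<otimes>\<^bsub>K\<^esub> inv\<^bsub>K\<^esub> s |a s. a \<in> A \<and> s \<in> A - P}"

text \<open>Polynomials over \<open>A\<close> are coefficient lists, leading coefficient first; the zero polynomial
  \<open>[]\<close>, whose head is unspecified, has to be excluded explicitly.\<close>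

definition integral_over :: "('a, 'b) ring_scheme \<Rightarrow> 'a set \<Rightarrow> 'a \<Rightarrow> bool" where
  "integral_over K A x \<longleftrightarrow>
     (\<exists>p \<in> carrier (A [X]\<^bsub>K\<^esub>). p \<noteq> [] \<and> hd p = \<one>\<^bsub>K\<^esub> \<and> ring.eval K p x = \<zero>\<^bsub>K\<^esub>)"

definition integral_closure :: "('a, 'b) ring_scheme \<Rightarrow> 'a set \<Rightarrow> 'a set" where
  "integral_closure K A = {x \<in> carrier K. integral_over K A x}"

end

theory Submission
  imports Defs
begin

text \<open>Write \<open>\<mm>\<close> for the set of nonunits of \<open>V\<close>. By minimality no other valuation overring lies
  inside \<open>V\<close>, so the sets of valuation overrings containing a given \<open>x \<notin> V\<close> cover
  \<open>Zar D - {V}\<close>. Compactness leaves finitely many such \<open>x\<close>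
  (\<open>finite_test_set_if_punctured_Zar_compact\<close>). Their inverses lie in \<open>\<mm>\<close>; adjoin them to \<open>D\<close> to get
  a ring \<open>A\<close>. A valuation ring \<open>W \<supseteq> A\<close> other than \<open>V\<close> contains one of the \<open>x\<close>, so the inverse of
  that \<open>x\<close> is a unit of \<open>W\<close>. Hence \<open>V\<close> is the only valuation ring above \<open>A\<close> whose nonunits
  contain \<open>M = A \<inter> \<mm>\<close>.

  This uniqueness gives everything else, because proper ideals are dominated by valuation rings:
  if \<open>I\<close> is a proper ideal of a subring \<open>B\<close> of the field, some valuation ring \<open>W \<supseteq> B\<close> has \<open>I\<close>
  among its nonunits (\<open>exists_dominating_valuation_ring\<close>).
  For a proper ideal \<open>J \<supseteq> M\<close> of \<open>A\<close> this \<open>W\<close> must be \<open>V\<close>, so \<open>J \<subseteq> M\<close> and \<open>M\<close> is maximal. For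
  \<open>0 \<noteq> x \<in> V\<close>, with \<open>y = 1/x\<close>, \<open>L\<close> the localization of \<open>A\<close> at \<open>M\<close> and \<open>N = L \<inter> \<mm>\<close>, consider the
  ideal \<open>N + y L[y]\<close> of \<open>L[y]\<close>. Were it proper, \<open>V\<close> would dominate it and
  \<open>y\<close> would be a nonunit of \<open>V\<close>, although \<open>x \<in> V\<close>. So \<open>1 = m + y b\<close> with \<open>m \<in> N\<close>, and as \<open>1 - m\<close> is
  a unit of \<open>L\<close>, the element \<open>x\<close> lies in \<open>L[1/x]\<close>; clearing denominators makes \<open>x\<close> integral
  over \<open>L\<close>. The converse inclusion holds because valuation rings are integrally closed.\<close>

section \<open>Ideals of subrings and values of polynomials\<close>

definition nonunits :: "('a, 'b) ring_scheme \<Rightarrow> 'a set \<Rightarrow> 'a set" where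
  "nonunits R V = {v \<in> V. \<forall>w \<in> V. v \<otimes>\<^bsub>R\<^esub> w \<noteq> \<one>\<^bsub>R\<^esub>}"

text \<open>The subring \<open>C\<close> and its ideal \<open>J\<close> vary together in the Zorn argument below, so both are
  treated as subsets of the one ambient ring; \<open>ideal_pair_iff_ideal\<close> links this to \<open>ideal\<close>.
  Closure of \<open>J\<close> under negatives follows from \<open>- 1 \<in> C\<close>.\<close>

definition ideal_pair :: "('a, 'b) ring_scheme \<Rightarrow> 'a set \<Rightarrow> 'a set \<Rightarrow> bool" where
  "ideal_pair R C J \<longleftrightarrow> subring C R \<and> J \<subseteq> C \<and> \<zero>\<^bsub>R\<^esub> \<in> J \<and>
     (\<forall>a \<in> J. \<forall>b \<in> J. a \<oplus>\<^bsub>R\<^esub> b \<in> J) \<and> (\<forall>c \<in> C. \<forall>a \<in> J. c \<otimes>\<^bsub>R\<^esub> a \<in> J)"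

text \<open>The values at \<open>x\<close> of polynomials of degree less than \<open>n\<close> with coefficients in \<open>J\<close>. Monomials
  may be added in any order and repeatedly, so that closure properties need checking on
  monomials only.\<close>

inductive_set poly_values :: "('a, 'b) ring_scheme \<Rightarrow> 'a set \<Rightarrow> 'a \<Rightarrow> nat \<Rightarrow> 'a set"
  for R and J and x and n where
  zero: "\<zero>\<^bsub>R\<^esub> \<in> poly_values R J x n"
| add_monom: "\<lbrakk>b \<in> J; i < n; p \<in> poly_values R J x n\<rbrakk>
    \<Longrightarrow> (b \<otimes>\<^bsub>R\<^esub> x [^]\<^bsub>R\<^esub> i) \<oplus>\<^bsub>R\<^esub> p \<in> poly_values R J x n"

definition poly_extension :: "('a, 'b) ring_scheme \<Rightarrow> 'a set \<Rightarrow> 'a \<Rightarrow> 'a set" where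
  "poly_extension R J x = (\<Union>n. poly_values R J x n)"

lemma ideal_pairD:
  assumes "ideal_pair R C J"
  shows "subring C R" "J \<subseteq> C" "\<zero>\<^bsub>R\<^esub> \<in> J"
    "\<And>a b. \<lbrakk>a \<in> J; b \<in> J\<rbrakk> \<Longrightarrow> a \<oplus>\<^bsub>R\<^esub> b \<in> J"
    "\<And>c a. \<lbrakk>c \<in> C; a \<in> J\<rbrakk> \<Longrightarrow> c \<otimes>\<^bsub>R\<^esub> a \<in> J"
    "J \<subseteq> carrier R" "C \<subseteq> carrier R"
  using assms subringE(1) unfolding ideal_pair_def by blast+

lemma ideal_pair_self: "subring C R \<Longrightarrow> ideal_pair R C C"
  by (auto simp: ideal_pair_def subringE)

context field
begin

lemma poly_values_carrier:
  assumes "J \<subseteq> carrier R" "x \<in> carrier R" "p \<in> poly_values R J x n"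
  shows "p \<in> carrier R"
  using assms(3)
  by induction (use assms(1,2) in auto)

lemma poly_values_monom:
  assumes "J \<subseteq> carrier R" "x \<in> carrier R" "b \<in> J" "i < n"
  shows "b \<otimes> x [^] i \<in> poly_values R J x n"
  using poly_values.add_monom[OF assms(3,4) poly_values.zero, of R x] assms
  by (simp add: subset_iff)

lemma poly_values_mono:
  assumes "p \<in> poly_values R I x m" "I \<subseteq> J" "m \<le> n"
  shows "p \<in> poly_values R J x n"
  using assms(1) by induction (use assms(2,3) in \<open>auto intro: poly_values.intros\<close>)

lemma poly_values_add:
  assumes "J \<subseteq> carrier R" "x \<in> carrier R"
    "p \<in> poly_values R J x n" "q \<in> poly_values R J x n"
  shows "p \<oplus> q \<in> poly_values R J x n"
  using assms(3)
proof induction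
  case zero
  then show ?case using poly_values_carrier[OF assms(1,2,4)] assms(4) by simp
next
  case (add_monom b i p)
  moreover have "b \<otimes> x [^] i \<oplus> p \<oplus> q = b \<otimes> x [^] i \<oplus> (p \<oplus> q)"
    using add_monom assms(1,2) poly_values_carrier[OF assms(1,2)] assms(4)
    by (intro a_assoc) auto
  ultimately show ?case by (simp add: poly_values.add_monom)
qed

lemma poly_values_mult_monom:
  assumes "ideal_pair R C J" "x \<in> carrier R" "c \<in> C" "q \<in> poly_values R J x n"
  shows "(c \<otimes> x [^] k) \<otimes> q \<in> poly_values R J x (k + n)"
  using assms(4)
proof induction
  case zero
  then show ?case using assms ideal_pairD(7)[OF assms(1)]
    by (simp add: subset_iff poly_values.zero)
next
  case (add_monom b i q)
  note J = ideal_pairD[OF assms(1)]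
  have car: "c \<in> carrier R" "b \<in> carrier R" "q \<in> carrier R"
    using J assms(3) add_monom poly_values_carrier[OF J(6) assms(2)] by auto
  have "c \<otimes> x [^] k \<otimes> (b \<otimes> x [^] i \<oplus> q)
      = c \<otimes> b \<otimes> (x [^] k \<otimes> x [^] i) \<oplus> c \<otimes> x [^] k \<otimes> q"
    using car assms(2) by (simp add: r_distr m_ac)
  also have "x [^] k \<otimes> x [^] i = x [^] (k + i)"
    using assms(2) by (simp add: nat_pow_mult)
  finally show ?case
    using add_monom J(5)[OF assms(3)] by (simp add: poly_values.add_monom)
qed

lemma poly_values_mult:
  assumes "ideal_pair R C J" "x \<in> carrier R"
    "p \<in> poly_values R C x m" "q \<in> poly_values R J x n"
  shows "p \<otimes> q \<in> poly_values R J x (m + n)"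
  using assms(3)
proof induction
  note J = ideal_pairD[OF assms(1)]
  have q: "q \<in> carrier R" using poly_values_carrier[OF J(6) assms(2,4)] .
  {
    case zero
    then show ?case using q by (auto intro: poly_values.zero)
  next
    case (add_monom b i p)
    have "b \<in> carrier R" "p \<in> carrier R"
      using J add_monom poly_values_carrier[OF J(7) assms(2)] by auto
    then have "(b \<otimes> x [^] i \<oplus> p) \<otimes> q = b \<otimes> x [^] i \<otimes> q \<oplus> p \<otimes> q"
      using q assms(2) by (simp add: l_distr)
    moreover have "b \<otimes> x [^] i \<otimes> q \<in> poly_values R J x (m + n)"
      using poly_values_mult_monom[OF assms(1,2) add_monom(1) assms(4), of i] add_monom(2)
      by (simp add: poly_values_mono[OF _ subset_refl])
    ultimately show ?case
      using poly_values_add[OF J(6) assms(2)] add_monom(4) by simp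
  }
qed

lemma poly_values_smult:
  assumes "ideal_pair R C J" "x \<in> carrier R" "c \<in> C" "q \<in> poly_values R J x n"
  shows "c \<otimes> q \<in> poly_values R J x n"
  using poly_values_mult_monom[OF assms, of 0] ideal_pairD(7)[OF assms(1)] assms(3)
  by (simp add: subset_iff)

lemma poly_values_top:
  assumes "ideal_pair R C J" "x \<in> carrier R" "p \<in> poly_values R J x (Suc n)"
  shows "\<exists>a \<in> J. \<exists>q \<in> poly_values R J x n. p = a \<otimes> x [^] n \<oplus> q"
  using assms(3)
proof induction
  note J = ideal_pairD[OF assms(1)]
  case zero
  then show ?case using assms(2) J(3) by (auto intro!: bexI[OF _ poly_values.zero] bexI[of _ \<zero>])
next
  note J = ideal_pairD[OF assms(1)]
  case (add_monom b i p)
  then obtain a q where aq: "a \<in> J" "q \<in> poly_values R J x n" "p = a \<otimes> x [^] n \<oplus> q" by blast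
  have car: "a \<in> carrier R" "b \<in> carrier R" "q \<in> carrier R"
    using J add_monom(1) aq poly_values_carrier[OF J(6) assms(2)] by auto
  show ?case
  proof (cases "i = n")
    case True
    have "b \<otimes> x [^] i \<oplus> p = (b \<oplus> a) \<otimes> x [^] n \<oplus> q"
      using car assms(2) aq True by (simp add: l_distr a_ac)
    then show ?thesis using J(4)[OF add_monom(1) aq(1)] aq(2) by blast
  next
    case False
    have "b \<otimes> x [^] i \<oplus> p = a \<otimes> x [^] n \<oplus> (b \<otimes> x [^] i \<oplus> q)"
      using car assms(2) aq by (simp add: a_ac)
    moreover have "b \<otimes> x [^] i \<oplus> q \<in> poly_values R J x n"
      using False add_monom aq by (simp add: poly_values.add_monom)
    ultimately show ?thesis using aq(1) by blast
  qed
qed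

lemma poly_values_bottom:
  assumes "ideal_pair R C J" "x \<in> carrier R" "p \<in> poly_values R J x (Suc n)"
  shows "\<exists>a \<in> J. \<exists>q \<in> poly_values R J x n. p = a \<oplus> x \<otimes> q"
  using assms(3)
proof induction
  note J = ideal_pairD[OF assms(1)]
  case zero
  then show ?case using assms(2) J(3) by (auto intro!: bexI[OF _ poly_values.zero] bexI[of _ \<zero>])
next
  note J = ideal_pairD[OF assms(1)]
  case (add_monom b i p)
  then obtain a q where aq: "a \<in> J" "q \<in> poly_values R J x n" "p = a \<oplus> x \<otimes> q" by blast
  have car: "a \<in> carrier R" "b \<in> carrier R" "q \<in> carrier R"
    using J add_monom(1) aq poly_values_carrier[OF J(6) assms(2)] by auto
  show ?case
  proof (cases i)
    case 0
    have "b \<otimes> x [^] i \<oplus> p = (b \<oplus> a) \<oplus> x \<otimes> q"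
      using car assms(2) aq 0 by (simp add: a_ac)
    then show ?thesis using J(4)[OF add_monom(1) aq(1)] aq(2) by blast
  next
    case (Suc k)
    have "b \<otimes> x [^] i \<oplus> p = a \<oplus> x \<otimes> (b \<otimes> x [^] k \<oplus> q)"
      using car assms(2) aq Suc by (simp add: a_ac m_ac r_distr)
    moreover have "b \<otimes> x [^] k \<oplus> q \<in> poly_values R J x n"
      using Suc add_monom aq by (simp add: poly_values.add_monom)
    ultimately show ?thesis using aq(1) by blast
  qed
qed

lemma pow_mult_inverse_pow:
  assumes "x \<in> carrier R" "y \<in> carrier R" "x \<otimes> y = \<one>"
  shows "x [^] (i + k) \<otimes> y [^] (i::nat) = x [^] (k::nat)"
proof -
  have "x [^] (i + k) \<otimes> y [^] i = (x \<otimes> y) [^] i \<otimes> x [^] k"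
    using assms(1,2) by (simp add: nat_pow_mult[symmetric] nat_pow_distrib m_ac)
  then show ?thesis using assms by simp
qed

text \<open>Since \<open>y = 1/x\<close>, multiplication by a high enough power of \<open>x\<close> turns polynomials in \<open>y\<close> into
  polynomials in \<open>x\<close>. This one fact serves the domination theorem and both halves of the
  integrality argument.\<close>

lemma poly_values_reverse:
  assumes "J \<subseteq> carrier R" "x \<in> carrier R" "y \<in> carrier R" "x \<otimes> y = \<one>"
    and "p \<in> poly_values R J y n" "n \<le> Suc m"
  shows "x [^] m \<otimes> p \<in> poly_values R J x (Suc m)"
  using assms(5)
proof induction
  case zero
  then show ?case using assms by (auto intro: poly_values.zero)
next
  case (add_monom b i p)
  have car: "b \<in> carrier R" "p \<in> carrier R"
    using add_monom assms(1) poly_values_carrier[OF assms(1,3)] by auto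
  have "x [^] m \<otimes> (b \<otimes> y [^] i \<oplus> p) = b \<otimes> (x [^] m \<otimes> y [^] i) \<oplus> x [^] m \<otimes> p"
    using car assms by (simp add: r_distr m_ac)
  also have "x [^] m \<otimes> y [^] i = x [^] (m - i)"
    using pow_mult_inverse_pow[OF assms(2-4), of i "m - i"] add_monom(2) assms(6) by simp
  finally show ?case using add_monom by (simp add: poly_values.add_monom)
qed

lemma poly_values_subset_ring:
  assumes "subring C R" "x \<in> C" "p \<in> poly_values R C x n"
  shows "p \<in> C"
  using assms(3)
proof induction
  case zero
  then show ?case using assms subringE(2) by blast
next
  case (add_monom b i p)
  have "x [^] i \<in> C" using assms
    by (induction i) (simp_all add: subringE(3,6)[OF assms(1)])
  then show ?case using add_monom subringE(6,7)[OF assms(1)] by simp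
qed

lemma poly_extension_ideal_pair:
  assumes "ideal_pair R C J" "x \<in> carrier R"
  shows "ideal_pair R (poly_extension R C x) (poly_extension R J x)"
proof -
  note J = ideal_pairD[OF assms(1)]
  have add: "p \<oplus> q \<in> poly_extension R I x"
    if pq: "p \<in> poly_extension R I x" "q \<in> poly_extension R I x" "I \<subseteq> carrier R" for p q I
  proof -
    obtain m n where mn: "p \<in> poly_values R I x m" "q \<in> poly_values R I x n"
      using pq(1,2) by (auto simp: poly_extension_def)
    have "p \<in> poly_values R I x (m + n)" "q \<in> poly_values R I x (m + n)"
      using poly_values_mono[OF mn(1) subset_refl] poly_values_mono[OF mn(2) subset_refl] by simp_all
    then show ?thesis
      using poly_values_add[OF pq(3) assms(2)] by (auto simp: poly_extension_def)
  qed
  have mult: "p \<otimes> q \<in> poly_extension R I x"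
    if "p \<in> poly_extension R C x" "q \<in> poly_extension R I x" "ideal_pair R C I" for p q I
    using that(1,2) poly_values_mult[OF that(3) assms(2)]
    unfolding poly_extension_def by blast
  have const: "c \<in> poly_extension R C x" if "c \<in> C" for c
    using poly_values_monom[OF J(7) assms(2) that, of 0 1] that J(7)
    by (auto simp: poly_extension_def subset_iff)
  have car: "poly_extension R C x \<subseteq> carrier R"
    using poly_values_carrier[OF J(7) assms(2)] by (auto simp: poly_extension_def)
  note CC = ideal_pair_self[OF J(1)]
  have "subring (poly_extension R C x) R"
  proof (rule subringI)
    show "poly_extension R C x \<subseteq> carrier R" by fact
    show "\<one> \<in> poly_extension R C x" using const subringE(3)[OF J(1)] by blast
    show "\<ominus> p \<in> poly_extension R C x" if "p \<in> poly_extension R C x" for p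
    proof -
      have "\<ominus> \<one> \<otimes> p \<in> poly_extension R C x"
        using mult[OF const that CC] subringE(3,5)[OF J(1)] by simp
      then show ?thesis using that car by (simp add: l_minus subset_iff)
    qed
    show "p \<otimes> q \<in> poly_extension R C x"
      if "p \<in> poly_extension R C x" "q \<in> poly_extension R C x" for p q
      using mult[OF that CC] .
    show "p \<oplus> q \<in> poly_extension R C x"
      if "p \<in> poly_extension R C x" "q \<in> poly_extension R C x" for p q
      using add[OF that J(7)] .
  qed
  moreover have "poly_extension R J x \<subseteq> poly_extension R C x"
    using poly_values_mono[OF _ J(2) order_refl] by (auto simp: poly_extension_def)
  moreover have "\<zero> \<in> poly_extension R J x"
    by (auto simp: poly_extension_def intro: poly_values.zero)
  ultimately show ?thesis
    using add[OF _ _ J(6)] mult[OF _ _ assms(1)] by (auto simp: ideal_pair_def)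
qed

lemma poly_extension_base:
  assumes "J \<subseteq> carrier R" "x \<in> carrier R"
  shows "J \<subseteq> poly_extension R J x"
proof
  fix c assume "c \<in> J"
  then show "c \<in> poly_extension R J x"
    using poly_values_monom[OF assms, of c 0 1] assms(1)
    by (auto simp: poly_extension_def subset_iff)
qed

lemma poly_extension_generator:
  assumes "subring C R" "x \<in> carrier R"
  shows "x \<in> poly_extension R C x"
  using poly_values_monom[OF subringE(1)[OF assms(1)] assms(2) subringE(3)[OF assms(1)], of 1 2]
    assms(2) by (auto simp: poly_extension_def)

text \<open>The elimination step behind the domination theorem. From \<open>1 = v + y w\<close> and
  \<open>1 = u x\<^sup>n + q\<close> with \<open>x y = 1\<close>, multiply the second equation by \<open>y w = 1 - v\<close>: the leading term
  becomes \<open>u (x\<^sup>n y) w\<close>, where \<open>w\<close> is a polynomial in \<open>y\<close> of degree less than \<open>n\<close>, so it is a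
  polynomial in \<open>x\<close> of degree less than \<open>n\<close>. Multiplying by \<open>1 - v\<close>, instead of dividing by it,
  makes the argument work over rings that are not local.\<close>

lemma lower_degree:
  assumes "ideal_pair R C J" "\<one> \<notin> J" "x \<in> carrier R" "y \<in> carrier R" "x \<otimes> y = \<one>"
    and "\<one> \<in> poly_values R J x n" "\<one> \<in> poly_values R J y m" "m \<le> n"
  shows "\<exists>k < n. \<one> \<in> poly_values R J x k"
proof -
  note J = ideal_pairD[OF assms(1)]
  have pos: "n > 0" if "\<one> \<in> poly_values R J z n" for z n
    using that by cases auto
  obtain n' m' where Suc: "n = Suc n'" "m = Suc m'"
    using pos[OF assms(6)] pos[OF assms(7)] by (auto simp: gr0_conv_Suc)
  obtain v w where v: "v \<in> J" "w \<in> poly_values R J y m'" "\<one> = v \<oplus> y \<otimes> w"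
    using poly_values_bottom[OF assms(1,4)] assms(7) Suc by blast
  obtain u q where u: "u \<in> J" "q \<in> poly_values R J x n'" "\<one> = u \<otimes> x [^] n' \<oplus> q"
    using poly_values_top[OF assms(1,3)] assms(6) Suc by blast
  have car: "u \<in> carrier R" "v \<in> carrier R" "q \<in> carrier R" "w \<in> carrier R"
    using u v J(6) poly_values_carrier[OF J(6)] assms(3,4) by blast+
  have "n' \<noteq> 0"
  proof
    assume "n' = 0"
    moreover from this have "q = \<zero>" using u(2) by (auto elim: poly_values.cases)
    ultimately have "\<one> = u" using u(3) car by simp
    then show False using u(1) assms(2) by simp
  qed
  then obtain k where k: "n' = Suc k" by (cases n') auto
  have "x [^] n' \<otimes> y = x [^] k"
    using pow_mult_inverse_pow[OF assms(3-5), of 1 k] k assms(4) by simp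
  then have "y \<otimes> w \<otimes> (u \<otimes> x [^] n') = u \<otimes> (x [^] k \<otimes> w)"
    using car assms(3,4) by (smt (verit) m_assoc m_comm m_closed nat_pow_closed)
  then have "y \<otimes> w \<otimes> (u \<otimes> x [^] n' \<oplus> q) = u \<otimes> (x [^] k \<otimes> w) \<oplus> y \<otimes> w \<otimes> q"
    using car assms(3,4) by (simp add: r_distr)
  then have "y \<otimes> w = u \<otimes> (x [^] k \<otimes> w) \<oplus> y \<otimes> w \<otimes> q"
    using car assms(4) by (simp flip: u(3))
  then have "\<one> = v \<oplus> (u \<otimes> (x [^] k \<otimes> w) \<oplus> y \<otimes> w \<otimes> q)"
    by (rule trans[OF v(3) arg_cong[of _ _ "\<lambda>z. v \<oplus> z"]])
  moreover have "v \<in> poly_values R J x n'"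
    using poly_values_monom[OF J(6) assms(3) v(1), of 0 n'] k car by simp
  moreover have "u \<otimes> (x [^] k \<otimes> w) \<in> poly_values R J x n'"
    using poly_values_reverse[OF J(6) assms(3-5) v(2), of k] k Suc assms(8)
      poly_values_smult[OF assms(1,3) subsetD[OF J(2) u(1)]] by simp
  moreover have "y \<otimes> w \<otimes> q \<in> poly_values R J x n'"
  proof -
    have "(v \<oplus> y \<otimes> w) \<ominus> v = y \<otimes> w"
      using car assms(4) by (simp add: a_minus_def a_ac r_neg2)
    then have "y \<otimes> w = \<one> \<oplus> \<ominus> v" by (simp add: a_minus_def flip: v(3))
    then have "y \<otimes> w \<in> C"
      using v(1) J(2) subringE(3,5,7)[OF J(1)] by auto
    then show ?thesis using poly_values_smult[OF assms(1,3) _ u(2)] by simp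
  qed
  ultimately have "\<one> \<in> poly_values R J x n'"
    using poly_values_add[OF J(6) assms(3)] by metis
  then show ?thesis using Suc by blast
qed

text \<open>If the ideal became improper in both extensions, \<open>lower_degree\<close> could be applied forever,
  with the roles of \<open>x\<close> and \<open>y\<close> exchanged whenever the degree in \<open>y\<close> is the larger one.\<close>

lemma proper_in_extension_by_element_or_inverse:
  assumes "ideal_pair R C J" "\<one> \<notin> J" "x \<in> carrier R" "y \<in> carrier R" "x \<otimes> y = \<one>"
  shows "\<one> \<notin> poly_extension R J x \<or> \<one> \<notin> poly_extension R J y"
proof -
  have yx: "y \<otimes> x = \<one>" using assms by (simp add: m_comm)
  have False if "\<one> \<in> poly_values R J x n" "\<one> \<in> poly_values R J y m" for n m
    using that
  proof (induction "n + m" arbitrary: n m rule: less_induct)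
    case less
    show ?case
    proof (cases "m \<le> n")
      case True
      then obtain k where "k < n" "\<one> \<in> poly_values R J x k"
        using lower_degree[OF assms] less.prems by blast
      then show ?thesis using less.hyps[of k m] less.prems by simp
    next
      case False
      then obtain k where "k < m" "\<one> \<in> poly_values R J y k"
        using lower_degree[OF assms(1,2,4,3) yx less.prems(2,1)] by auto
      then show ?thesis using less.hyps[of n k] less.prems by simp
    qed
  qed
  then show ?thesis by (auto simp: poly_extension_def)
qed

section \<open>Domination by valuation rings\<close>

lemma valuation_ring_ofI:
  assumes "subring C R"
    and "\<And>x y. \<lbrakk>x \<in> carrier R; y \<in> carrier R; x \<otimes> y = \<one>\<rbrakk> \<Longrightarrow> x \<in> C \<or> y \<in> C"
  shows "valuation_ring_of R C"
proof -
  have inv: "inv x \<in> carrier R" "x \<otimes> inv x = \<one>" "inv x \<noteq> \<zero>" "inv (inv x) = x"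
    if "x \<in> carrier R - {\<zero>}" for x
    using that field_Units by (auto simp: Units_inv_inv)
  have dich: "\<forall>x \<in> carrier R - {\<zero>}. x \<in> C \<or> inv x \<in> C"
    using assms(2) inv by blast
  have "\<exists>a \<in> C. \<exists>b \<in> C - {\<zero>}. x = a \<otimes> inv b" if "x \<in> carrier R" for x
  proof (cases "x \<in> C")
    case True
    then show ?thesis using that subringE(3)[OF assms(1)]
      by (intro bexI[of _ x] bexI[of _ \<one>]) (auto simp: one_not_zero)
  next
    case False
    then have "x \<noteq> \<zero>" using subringE(2)[OF assms(1)] by blast
    then show ?thesis using that False dich inv[of x] subringE(3)[OF assms(1)]
      by (intro bexI[of _ \<one>] bexI[of _ "inv x"]) auto
  qed
  then show ?thesis
    using assms(1) dich subdomainI'[OF assms(1)]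
    by (simp add: valuation_ring_of_def has_quotient_field_def)
qed

text \<open>Among all pairs of a subring and a proper ideal above \<open>(B, I)\<close> take a maximal one
  \<open>(C, J)\<close>. It absorbs every \<open>x\<close> for which \<open>J[x]\<close> is proper in \<open>C[x]\<close>, and of \<open>x\<close> and \<open>1/x\<close> one
  always has this property, so \<open>C\<close> is a valuation ring. Maximizing the ideal along with the ring
  avoids ideals generated in varying rings.\<close>

lemma exists_dominating_valuation_ring:
  assumes "ideal_pair R B I" "\<one> \<notin> I"
  shows "\<exists>W. valuation_ring_of R W \<and> B \<subseteq> W \<and> I \<subseteq> nonunits R W"
proof -
  \<comment> \<open>A pair is coded as one set in the disjoint sum, so that Zorn's lemma for inclusion applies.\<close>
  define ring_part :: "('a + 'a) set \<Rightarrow> 'a set" where "ring_part U = {c. Inl c \<in> U}" for U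
  define ideal_part :: "('a + 'a) set \<Rightarrow> 'a set" where "ideal_part U = {a. Inr a \<in> U}" for U
  define \<A> where "\<A> = {U. Inl ` B \<union> Inr ` I \<subseteq> U \<and> ideal_pair R (ring_part U) (ideal_part U) \<and>
    \<one> \<notin> ideal_part U}"
  have parts [simp]: "ring_part (Inl ` C \<union> Inr ` J) = C" "ideal_part (Inl ` C \<union> Inr ` J) = J" for C J
    by (auto simp: ring_part_def ideal_part_def)
  have "\<exists>U \<in> \<A>. \<forall>Y \<in> \<A>. U \<subseteq> Y \<longrightarrow> Y = U"
  proof (rule subset_Zorn_nonempty)
    show "\<A> \<noteq> {}" using assms by (auto simp: \<A>_def intro!: exI[of _ "Inl ` B \<union> Inr ` I"])
    fix \<C> assume ne: "\<C> \<noteq> {}" and chain: "subset.chain \<A> \<C>"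
    have mem: "Inl ` B \<union> Inr ` I \<subseteq> U" "ideal_pair R (ring_part U) (ideal_part U)" "\<one> \<notin> ideal_part U"
      if "U \<in> \<C>" for U
    proof -
      have "U \<in> \<A>" using that chain unfolding subset_chain_def by blast
      then show "Inl ` B \<union> Inr ` I \<subseteq> U" "ideal_pair R (ring_part U) (ideal_part U)"
        "\<one> \<notin> ideal_part U" unfolding \<A>_def by blast+
    qed
    \<comment> \<open>In a chain two elements already lie in one member, so closure passes to the union.\<close>
    have common: "\<exists>U \<in> \<C>. p \<in> U \<and> q \<in> U" if pq: "p \<in> \<Union>\<C>" "q \<in> \<Union>\<C>" for p q
    proof -
      obtain U U' where "U \<in> \<C>" "p \<in> U" "U' \<in> \<C>" "q \<in> U'" using pq by blast
      moreover from this have "U \<subseteq> U' \<or> U' \<subseteq> U" using chain unfolding subset_chain_def by blast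
      ultimately show ?thesis by blast
    qed
    have mem_ring: "c \<in> ring_part U \<longleftrightarrow> Inl c \<in> U" and mem_ideal: "a \<in> ideal_part U \<longleftrightarrow> Inr a \<in> U"
      for a c U by (auto simp: ring_part_def ideal_part_def)
    have "subring (ring_part (\<Union>\<C>)) R"
    proof (rule subringI)
      show "ring_part (\<Union>\<C>) \<subseteq> carrier R"
        using mem(2) ideal_pairD(7) by (fastforce simp: mem_ring)
      show "\<one> \<in> ring_part (\<Union>\<C>)"
        using ne mem(2) subringE(3)[OF ideal_pairD(1)] by (fastforce simp: mem_ring)
      show "\<ominus> c \<in> ring_part (\<Union>\<C>)" if "c \<in> ring_part (\<Union>\<C>)" for c
        using that mem(2) subringE(5)[OF ideal_pairD(1)] by (fastforce simp: mem_ring)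
      show "c \<otimes> d \<in> ring_part (\<Union>\<C>)" "c \<oplus> d \<in> ring_part (\<Union>\<C>)"
        if cd: "c \<in> ring_part (\<Union>\<C>)" "d \<in> ring_part (\<Union>\<C>)" for c d
      proof -
        obtain U where "U \<in> \<C>" "c \<in> ring_part U" "d \<in> ring_part U"
          using common[OF cd[unfolded mem_ring]] unfolding mem_ring by blast
        then show "c \<otimes> d \<in> ring_part (\<Union>\<C>)" "c \<oplus> d \<in> ring_part (\<Union>\<C>)"
          using subringE(6,7)[OF ideal_pairD(1)[OF mem(2)]] unfolding mem_ring by blast+
      qed
    qed
    moreover have "ideal_part (\<Union>\<C>) \<subseteq> ring_part (\<Union>\<C>)"
      using ideal_pairD(2)[OF mem(2)] by (fastforce simp: mem_ring mem_ideal)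
    moreover have "\<zero> \<in> ideal_part (\<Union>\<C>)"
      using ne ideal_pairD(3)[OF mem(2)] by (fastforce simp: mem_ideal)
    moreover have "a \<oplus> b \<in> ideal_part (\<Union>\<C>)"
      if ab: "a \<in> ideal_part (\<Union>\<C>)" "b \<in> ideal_part (\<Union>\<C>)" for a b
    proof -
      obtain U where "U \<in> \<C>" "a \<in> ideal_part U" "b \<in> ideal_part U"
        using common[OF ab[unfolded mem_ideal]] unfolding mem_ideal by blast
      then show ?thesis using ideal_pairD(4)[OF mem(2)] by (auto simp: mem_ideal)
    qed
    moreover have "c \<otimes> a \<in> ideal_part (\<Union>\<C>)"
      if ca: "c \<in> ring_part (\<Union>\<C>)" "a \<in> ideal_part (\<Union>\<C>)" for c a
    proof -
      obtain U where "U \<in> \<C>" "c \<in> ring_part U" "a \<in> ideal_part U"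
        using common[OF ca[unfolded mem_ring mem_ideal]] unfolding mem_ring mem_ideal by blast
      then show ?thesis using ideal_pairD(5)[OF mem(2)] by (auto simp: mem_ideal)
    qed
    moreover have "\<one> \<notin> ideal_part (\<Union>\<C>)" using mem(3) by (auto simp: mem_ideal)
    moreover have "Inl ` B \<union> Inr ` I \<subseteq> \<Union>\<C>" using ne mem(1) by blast
    ultimately show "\<Union>\<C> \<in> \<A>" by (auto simp: \<A>_def ideal_pair_def)
  qed
  then obtain U where U: "U \<in> \<A>" and maxU: "\<And>Y. Y \<in> \<A> \<Longrightarrow> U \<subseteq> Y \<Longrightarrow> Y = U" by blast
  define C J where "C = ring_part U" and "J = ideal_part U"
  have pair: "ideal_pair R C J" "\<one> \<notin> J" and BI: "B \<subseteq> C" "I \<subseteq> J"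
    using U by (auto simp: \<A>_def C_def J_def ring_part_def ideal_part_def)
  note CJ = ideal_pairD[OF pair(1)]
  have UCJ: "U = Inl ` C \<union> Inr ` J"
  proof -
    have "p \<in> U \<longleftrightarrow> p \<in> Inl ` C \<union> Inr ` J" for p
      by (cases p) (auto simp: C_def J_def ring_part_def ideal_part_def)
    then show ?thesis by blast
  qed
  have absorb: "x \<in> C" if "x \<in> carrier R" "\<one> \<notin> poly_extension R J x" for x
  proof -
    have base: "C \<subseteq> poly_extension R C x" "J \<subseteq> poly_extension R J x"
      using poly_extension_base CJ(6,7) that(1) by auto
    have "Inl ` poly_extension R C x \<union> Inr ` poly_extension R J x \<in> \<A>"
      using poly_extension_ideal_pair[OF pair(1) that(1)] that(2) base BI
      by (auto simp: \<A>_def)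
    moreover have "U \<subseteq> Inl ` poly_extension R C x \<union> Inr ` poly_extension R J x"
      using base by (auto simp: UCJ)
    ultimately have "Inl ` poly_extension R C x \<union> Inr ` poly_extension R J x = U" by (rule maxU)
    then have "poly_extension R C x = C" using parts(1) C_def by metis
    then show ?thesis using poly_extension_generator[OF CJ(1) that(1)] by simp
  qed
  have "valuation_ring_of R C"
    using valuation_ring_ofI[OF CJ(1)] absorb
      proper_in_extension_by_element_or_inverse[OF pair] by metis
  moreover have "I \<subseteq> nonunits R C"
  proof
    fix a assume "a \<in> I"
    then have a: "a \<in> J" "a \<in> C" using BI CJ(2) by auto
    have "a \<otimes> w \<noteq> \<one>" if "w \<in> C" for w
      using CJ(5)[OF that a(1)] pair(2) a(2) that CJ(7) m_comm by (metis subsetD)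
    then show "a \<in> nonunits R C" using a by (simp add: nonunits_def)
  qed
  ultimately show ?thesis using BI(1) by blast
qed

section \<open>Valuation rings and integrality\<close>

lemma valuation_ring_ofD:
  assumes "valuation_ring_of R V"
  shows "subring V R" "V \<subseteq> carrier R"
    "\<And>x y. \<lbrakk>x \<in> carrier R; y \<in> carrier R; x \<otimes> y = \<one>\<rbrakk> \<Longrightarrow> x \<in> V \<or> y \<in> V"
proof -
  show sub: "subring V R"
    using assms unfolding valuation_ring_of_def subdomain_def subcring_def by blast
  then show "V \<subseteq> carrier R" by (rule subringE(1))
  fix x y assume xy: "x \<in> carrier R" "y \<in> carrier R" "x \<otimes> y = \<one>"
  then have "x \<noteq> \<zero>" by auto
  moreover have "inv x = y" using xy by (simp add: comm_inv_char)
  ultimately show "x \<in> V \<or> y \<in> V"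
    using assms xy(1) unfolding valuation_ring_of_def by blast
qed

text \<open>For the sum of nonunits \<open>a\<close>, \<open>b\<close>, one of \<open>a/b\<close> and \<open>b/a\<close> lies in \<open>V\<close>; in the first case
  \<open>a + b = (1 + a/b) b\<close> is a multiple of a nonunit.\<close>

lemma nonunits_ideal:
  assumes "valuation_ring_of R V"
  shows "ideal_pair R V (nonunits R V)" "\<one> \<notin> nonunits R V"
proof -
  note V = valuation_ring_ofD[OF assms]
  note sub = subringE[OF V(1)]
  show one: "\<one> \<notin> nonunits R V" using sub(3) by (auto simp: nonunits_def intro!: bexI[of _ \<one>])
  have mult: "c \<otimes> a \<in> nonunits R V" if c: "c \<in> V" and a: "a \<in> nonunits R V" for c a
  proof -
    have aV: "a \<in> V" using a by (simp add: nonunits_def)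
    have "c \<otimes> a \<otimes> w \<noteq> \<one>" if w: "w \<in> V" for w
    proof -
      have "a \<otimes> (c \<otimes> w) \<noteq> \<one>" using a c w sub(6) by (simp add: nonunits_def)
      moreover have "c \<otimes> a \<otimes> w = a \<otimes> (c \<otimes> w)"
        using c w aV V(2) by (simp add: subset_iff m_ac)
      ultimately show ?thesis by simp
    qed
    then show ?thesis using c aV sub(6) by (simp add: nonunits_def)
  qed
  have add_aux: "a \<oplus> b \<in> nonunits R V"
    if a: "a \<in> V" and b: "b \<in> nonunits R V" "b \<noteq> \<zero>" and d: "a \<otimes> inv b \<in> V" for a b
  proof -
    have car: "a \<in> carrier R" "b \<in> carrier R" using a b V(2) by (auto simp: nonunits_def)
    then have unit: "b \<in> Units R" using b(2) field_Units by blast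
    have "(\<one> \<oplus> a \<otimes> inv b) \<otimes> b \<in> nonunits R V"
      using mult[OF _ b(1)] d sub(3,7) by simp
    moreover have "(\<one> \<oplus> a \<otimes> inv b) \<otimes> b = b \<oplus> a"
      using car unit by (simp add: l_distr m_assoc)
    ultimately show ?thesis using car by (simp add: a_comm)
  qed
  have add: "a \<oplus> b \<in> nonunits R V" if a: "a \<in> nonunits R V" and b: "b \<in> nonunits R V" for a b
  proof -
    have mem: "a \<in> V" "b \<in> V" using a b by (auto simp: nonunits_def)
    then have car: "a \<in> carrier R" "b \<in> carrier R" using V(2) by auto
    show ?thesis
    proof (cases "a = \<zero> \<or> b = \<zero>")
      case True
      then show ?thesis using a b car by auto
    next
      case False
      then have unit: "a \<in> Units R" "b \<in> Units R" using car field_Units by auto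
      have "(a \<otimes> inv b) \<otimes> (b \<otimes> inv a) = (a \<otimes> inv a) \<otimes> (b \<otimes> inv b)"
        using car unit by (simp add: m_ac del: Units_r_inv Units_l_inv)
      then have "(a \<otimes> inv b) \<otimes> (b \<otimes> inv a) = \<one>" using unit by simp
      then have "a \<otimes> inv b \<in> V \<or> b \<otimes> inv a \<in> V" using V(3) car unit by simp
      then show ?thesis
      proof
        assume "a \<otimes> inv b \<in> V"
        then show ?thesis using add_aux mem b False by blast
      next
        assume "b \<otimes> inv a \<in> V"
        then have "b \<oplus> a \<in> nonunits R V" using add_aux mem a False by blast
        then show ?thesis using car by (simp add: a_comm)
      qed
    qed
  qed
  have "\<zero> \<in> nonunits R V"
    using sub(1,2) by (auto simp: nonunits_def)
  then show "ideal_pair R V (nonunits R V)"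
    using V(1) add mult by (auto simp: ideal_pair_def nonunits_def)
qed

lemma ideal_pair_iff_ideal:
  assumes "subring A R"
  shows "ideal_pair R A M \<longleftrightarrow> ideal M (R\<lparr>carrier := A\<rparr>)"
proof
  assume "ideal_pair R A M"
  note M = ideal_pairD[OF this]
  interpret A: ring "R\<lparr>carrier := A\<rparr>" using subring_is_ring[OF assms] .
  show "ideal M (R\<lparr>carrier := A\<rparr>)"
  proof (rule idealI)
    show "ring (R\<lparr>carrier := A\<rparr>)" ..
    show "subgroup M (add_monoid (R\<lparr>carrier := A\<rparr>))"
    proof
      fix a assume a: "a \<in> M"
      have "\<ominus>\<^bsub>R\<lparr>carrier := A\<rparr>\<^esub> a
          = \<ominus>\<^bsub>R\<lparr>carrier := A\<rparr>\<^esub> \<one>\<^bsub>R\<lparr>carrier := A\<rparr>\<^esub> \<otimes>\<^bsub>R\<lparr>carrier := A\<rparr>\<^esub> a"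
        using a M(2) A.l_minus[OF A.one_closed, of a] A.l_one[of a] by auto
      moreover have "\<ominus>\<^bsub>R\<lparr>carrier := A\<rparr>\<^esub> \<one>\<^bsub>R\<lparr>carrier := A\<rparr>\<^esub> \<in> A"
        using A.a_inv_closed[OF A.one_closed] by simp
      ultimately have "\<ominus>\<^bsub>R\<lparr>carrier := A\<rparr>\<^esub> a \<in> M" using M(5)[OF _ a] by simp
      then show "inv\<^bsub>add_monoid (R\<lparr>carrier := A\<rparr>)\<^esub> a \<in> M" by (simp add: a_inv_def)
    qed (use M in auto)
    fix a c assume ac: "a \<in> M" "c \<in> carrier (R\<lparr>carrier := A\<rparr>)"
    then show "c \<otimes>\<^bsub>R\<lparr>carrier := A\<rparr>\<^esub> a \<in> M" using M(5) by simp
    then show "a \<otimes>\<^bsub>R\<lparr>carrier := A\<rparr>\<^esub> c \<in> M"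
      using ac M(6,7) by (simp add: m_comm subset_iff)
  qed
next
  assume "ideal M (R\<lparr>carrier := A\<rparr>)"
  then interpret M: ideal M "R\<lparr>carrier := A\<rparr>" .
  show "ideal_pair R A M"
    using assms M.a_subset additive_subgroup.zero_closed[OF M.additive_subgroup_axioms]
      additive_subgroup.a_closed[OF M.additive_subgroup_axioms] M.I_l_closed
    by (auto simp: ideal_pair_def)
qed

text \<open>Coefficient lists may here have leading zeros, unlike the polynomials of \<open>univ_poly\<close>.\<close>

lemma poly_values_eq_evals:
  assumes "subring C R" "x \<in> carrier R"
  shows "poly_values R C x n = {eval l x |l. set l \<subseteq> C \<and> length l = n}"
proof (intro equalityI subsetI)
  note C = ideal_pair_self[OF assms(1)]
  fix p assume "p \<in> poly_values R C x n"
  then show "p \<in> {eval l x |l. set l \<subseteq> C \<and> length l = n}"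
  proof (induction n arbitrary: p)
    case 0
    then show ?case by (auto elim: poly_values.cases)
  next
    case (Suc n)
    then obtain a q where aq: "a \<in> C" "q \<in> poly_values R C x n" "p = a \<otimes> x [^] n \<oplus> q"
      using poly_values_top[OF C assms(2)] by blast
    then obtain l where "set l \<subseteq> C" "length l = n" "q = eval l x" using Suc.IH by blast
    then show ?case using aq by (intro CollectI exI[of _ "a # l"]) auto
  qed
next
  fix p assume "p \<in> {eval l x |l. set l \<subseteq> C \<and> length l = n}"
  then obtain l where "set l \<subseteq> C" "length l = n" "p = eval l x" by blast
  then show "p \<in> poly_values R C x n"
  proof (induction l arbitrary: n p)
    case Nil
    then show ?case by (simp add: poly_values.zero)
  next
    case (Cons a l)
    have "eval l x \<in> poly_values R C x n"
      by (rule poly_values_mono[OF Cons.IH[OF _ refl refl] subset_refl]) (use Cons in auto)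
    then show ?case using Cons.prems by (auto intro!: poly_values.add_monom)
  qed
qed

text \<open>A monic relation of degree \<open>n\<close> says that \<open>x\<^sup>n\<close> is a combination of lower powers. The case
  \<open>n = 0\<close> is harmless: it would mean \<open>1 = 0\<close>.\<close>

lemma integral_over_iff_power:
  assumes "subring C R" "x \<in> carrier R"
  shows "integral_over R C x \<longleftrightarrow> (\<exists>n. x [^] n \<in> poly_values R C x n)"
proof -
  note C = subringE[OF assms(1)]
  have neg: "\<ominus> p \<in> poly_values R C x n" if "p \<in> poly_values R C x n" for p n
  proof -
    have "\<ominus> \<one> \<otimes> p \<in> poly_values R C x n"
      using poly_values_smult[OF ideal_pair_self[OF assms(1)] assms(2) _ that] C(3,5) by simp
    then show ?thesis using poly_values_carrier[OF C(1) assms(2) that] by (simp add: l_minus)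
  qed
  have monic: "(p \<in> carrier (C [X]\<^bsub>R\<^esub>) \<and> p \<noteq> [] \<and> hd p = \<one>) \<longleftrightarrow> (\<exists>l. set l \<subseteq> C \<and> p = \<one> # l)" for p
    using C(3) one_not_zero
    by (cases p) (auto simp: univ_poly_carrier[symmetric] polynomial_def)
  have "integral_over R C x \<longleftrightarrow> (\<exists>l. set l \<subseteq> C \<and> x [^] length l \<oplus> eval l x = \<zero>)"
  proof -
    have "integral_over R C x \<longleftrightarrow> (\<exists>p. (p \<in> carrier (C [X]\<^bsub>R\<^esub>) \<and> p \<noteq> [] \<and> hd p = \<one>) \<and> eval p x = \<zero>)"
      unfolding integral_over_def by blast
    also have "\<dots> \<longleftrightarrow> (\<exists>l. set l \<subseteq> C \<and> eval (\<one> # l) x = \<zero>)"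
      unfolding monic by blast
    finally show ?thesis using assms(2) by simp
  qed
  also have "\<dots> \<longleftrightarrow> (\<exists>n. \<exists>q \<in> poly_values R C x n. x [^] n \<oplus> q = \<zero>)"
    unfolding poly_values_eq_evals[OF assms] by blast
  also have "\<dots> \<longleftrightarrow> (\<exists>n. x [^] n \<in> poly_values R C x n)"
  proof (intro ex_cong1 iffI)
    fix n assume "\<exists>q \<in> poly_values R C x n. x [^] n \<oplus> q = \<zero>"
    then obtain q where q: "q \<in> poly_values R C x n" "x [^] n \<oplus> q = \<zero>" by blast
    then have "x [^] n = \<ominus> q"
      using assms(2) poly_values_carrier[OF C(1) assms(2)] by (simp add: minus_equality)
    then show "x [^] n \<in> poly_values R C x n" using neg q(1) by simp
  next
    fix n assume "x [^] n \<in> poly_values R C x n"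
    then show "\<exists>q \<in> poly_values R C x n. x [^] n \<oplus> q = \<zero>"
      using neg assms(2) by (intro bexI[of _ "\<ominus> (x [^] n)"]) (auto simp: r_neg)
  qed
  finally show ?thesis .
qed

text \<open>If \<open>x \<notin> V\<close> then \<open>y = 1/x \<in> V\<close>, and multiplying the relation for \<open>x\<^sup>n\<close> by \<open>n - 1\<close> factors
  \<open>y\<close> writes \<open>x\<close> as a polynomial in \<open>y\<close> with coefficients in \<open>V\<close>.\<close>

lemma valuation_ring_integrally_closed:
  assumes "valuation_ring_of R V" "subring C R" "C \<subseteq> V" "x \<in> carrier R" "integral_over R C x"
  shows "x \<in> V"
proof (rule ccontr)
  assume "x \<notin> V"
  note V = valuation_ring_ofD[OF assms(1)]
  note C = subringE[OF assms(2)]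
  have "x \<noteq> \<zero>" using \<open>x \<notin> V\<close> subringE(2)[OF V(1)] by blast
  then obtain y where y: "y \<in> carrier R" "x \<otimes> y = \<one>"
    using assms(4) field_Units by (metis DiffI Units_inv_closed Units_r_inv singletonD)
  have yx: "y \<otimes> x = \<one>" using y assms(4) by (simp add: m_comm)
  have "y \<in> V" using V(3)[OF assms(4) y] \<open>x \<notin> V\<close> by blast
  obtain n where n: "x [^] n \<in> poly_values R C x n"
    using assms integral_over_iff_power by blast
  have "n \<noteq> 0"
  proof
    assume "n = 0"
    then have "\<one> \<in> poly_values R C x 0" using n by simp
    then show False by (auto elim: poly_values.cases)
  qed
  then obtain m where m: "n = Suc m" by (cases n) auto
  have "y [^] m \<otimes> x [^] n \<in> poly_values R C y (Suc m)"
    using poly_values_reverse[OF C(1) y(1) assms(4) yx n] m by simp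
  moreover have "y [^] m \<otimes> x [^] n = x"
    using pow_mult_inverse_pow[OF assms(4) y, of m 1] m y assms(4) by (simp add: m_comm)
  ultimately have "x \<in> poly_values R V y (Suc m)"
    using poly_values_mono[OF _ assms(3) order_refl] by simp
  then show False using poly_values_subset_ring[OF V(1) \<open>y \<in> V\<close>] \<open>x \<notin> V\<close> by blast
qed

text \<open>The hypotheses force \<open>b = x\<close>. Thus \<open>x\<close> is a polynomial in \<open>1/x\<close>, and multiplying by a power
  of \<open>x\<close> gives a monic relation.\<close>

lemma integral_over_of_one_in_inverse_span:
  assumes "subring C R" "x \<in> carrier R" "y \<in> carrier R" "x \<otimes> y = \<one>"
    and "b \<in> poly_values R C y n" "y \<otimes> b = \<one>"
  shows "integral_over R C x"
proof -
  note C = subringE[OF assms(1)]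
  have b: "b \<in> carrier R" using poly_values_carrier[OF C(1) assms(3,5)] .
  have "b = (x \<otimes> y) \<otimes> b" using assms(4) b by simp
  also have "\<dots> = x" using assms(2,3,6) b by (simp add: m_assoc)
  finally have bx: "b = x" .
  have "n \<noteq> 0" using assms(3,5,6) by (auto elim: poly_values.cases)
  then obtain m where m: "n = Suc m" by (cases n) auto
  have "x [^] m \<otimes> b \<in> poly_values R C x (Suc m)"
    using poly_values_reverse[OF C(1) assms(2-5)] m by simp
  then have "x [^] Suc m \<in> poly_values R C x (Suc m)" using bx by simp
  then show ?thesis using integral_over_iff_power assms(1,2) by blast
qed

lemma localization_at_iff:
  assumes "subring A R" "\<zero> \<in> M"
  shows "r \<in> localization_at R A M \<longleftrightarrow> r \<in> carrier R \<and> (\<exists>s \<in> A - M. s \<otimes> r \<in> A)"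
proof -
  note A = subringE[OF assms(1)]
  have unit: "s \<in> Units R" if "s \<in> A - M" for s
    using that assms(2) A(1) field_Units by blast
  show ?thesis
  proof
    assume "r \<in> localization_at R A M"
    then obtain a s where as: "a \<in> A" "s \<in> A - M" "r = a \<otimes> inv s"
      by (auto simp: localization_at_def)
    have car: "a \<in> carrier R" "s \<in> carrier R" "inv s \<in> carrier R"
      using as A(1) unit[OF as(2)] by auto
    have "s \<otimes> r = a \<otimes> (s \<otimes> inv s)" using as(3) car by (simp add: m_ac del: Units_r_inv)
    then have "s \<otimes> r = a" using unit[OF as(2)] car by simp
    moreover have "r \<in> carrier R" using as(3) car by simp
    ultimately show "r \<in> carrier R \<and> (\<exists>s \<in> A - M. s \<otimes> r \<in> A)" using as(1,2) by blast
  next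
    assume "r \<in> carrier R \<and> (\<exists>s \<in> A - M. s \<otimes> r \<in> A)"
    then obtain s where s: "r \<in> carrier R" "s \<in> A - M" "s \<otimes> r \<in> A" by blast
    have "(s \<otimes> r) \<otimes> inv s = r \<otimes> (s \<otimes> inv s)"
      using s(1) unit[OF s(2)] by (simp add: Units_closed m_ac del: Units_r_inv)
    then have "r = (s \<otimes> r) \<otimes> inv s" using s(1) unit[OF s(2)] by simp
    then show "r \<in> localization_at R A M" using s by (auto simp: localization_at_def)
  qed
qed

end

section \<open>Localization at the center of a valuation ring\<close>

locale ring_below_valuation = field +
  fixes A V
  assumes A: "subring A R" and V: "valuation_ring_of R V" and AV: "A \<subseteq> V"
begin

text \<open>The contraction to \<open>A\<close> of the maximal ideal of \<open>V\<close>, known as the center of \<open>V\<close> on \<open>A\<close>.\<close>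

definition center where "center = A \<inter> nonunits R V"

definition local_ring where "local_ring = localization_at R A center"

text \<open>The maximal ideal of the local ring, obtained by contraction from \<open>V\<close>.\<close>

definition local_ideal where "local_ideal = local_ring \<inter> nonunits R V"

lemmas nonunits_V = ideal_pairD[OF nonunits_ideal(1)[OF V]]

lemma ideal_center: "ideal_pair R A center"
  using nonunits_V A AV subringE(6,7)[OF A] subringE(2)[OF A]
  by (auto simp: ideal_pair_def center_def)

text \<open>The elements of \<open>A\<close> outside the center are those that are invertible in \<open>V\<close>. This makes them
  multiplicatively closed and puts the localization inside \<open>V\<close>.\<close>

lemma denominator_iff: "s \<in> A - center \<longleftrightarrow> s \<in> A \<and> (\<exists>w \<in> V. s \<otimes> w = \<one>)"
  using AV by (auto simp: center_def nonunits_def)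

lemma denominator_mult:
  assumes "s \<in> A - center" "t \<in> A - center"
  shows "s \<otimes> t \<in> A - center"
proof -
  obtain v w where vw: "v \<in> V" "w \<in> V" "s \<otimes> v = \<one>" "t \<otimes> w = \<one>" "s \<in> A" "t \<in> A"
    using assms unfolding denominator_iff by blast
  then have "s \<in> carrier R" "t \<in> carrier R" "v \<in> carrier R" "w \<in> carrier R"
    using nonunits_V(7) AV by auto
  then have "(s \<otimes> t) \<otimes> (v \<otimes> w) = (s \<otimes> v) \<otimes> (t \<otimes> w)" by (simp add: m_ac)
  then have "(s \<otimes> t) \<otimes> (v \<otimes> w) = \<one>" using vw by simp
  then show ?thesis unfolding denominator_iff
    using vw subringE(6)[OF A] subringE(6)[OF nonunits_V(1)] by blast
qed

lemma mem_local_ring: "r \<in> local_ring \<longleftrightarrow> r \<in> carrier R \<and> (\<exists>s \<in> A - center. s \<otimes> r \<in> A)"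
  unfolding local_ring_def using localization_at_iff[OF A ideal_pairD(3)[OF ideal_center]] .

lemma A_subset_local_ring: "A \<subseteq> local_ring"
proof
  fix a assume "a \<in> A"
  moreover have "\<one> \<in> A - center"
    using subringE(3)[OF A] nonunits_ideal(2)[OF V] by (auto simp: center_def)
  moreover have "a \<in> carrier R" using \<open>a \<in> A\<close> subringE(1)[OF A] by blast
  ultimately show "a \<in> local_ring" unfolding mem_local_ring by (auto intro!: bexI[of _ \<one>])
qed

lemma subring_local_ring: "subring local_ring R"
proof (rule subringI)
  note sub = subringE[OF A]
  show car: "local_ring \<subseteq> carrier R" by (auto simp: mem_local_ring)
  show "\<one> \<in> local_ring" using A_subset_local_ring sub(3) by blast
  show "\<ominus> r \<in> local_ring" if r: "r \<in> local_ring" for r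
  proof -
    obtain s where s: "s \<in> A - center" "s \<otimes> r \<in> A" "r \<in> carrier R" using r by (auto simp: mem_local_ring)
    moreover have "s \<in> carrier R" using s(1) sub(1) by blast
    ultimately have "s \<otimes> \<ominus> r \<in> A" using sub(5) by (simp add: r_minus)
    then show ?thesis using s by (auto simp: mem_local_ring)
  qed
  fix r q assume r: "r \<in> local_ring" and q: "q \<in> local_ring"
  obtain s t where st: "s \<in> A - center" "s \<otimes> r \<in> A" "t \<in> A - center" "t \<otimes> q \<in> A"
    using r q by (auto simp: mem_local_ring)
  have c: "s \<in> carrier R" "t \<in> carrier R" "r \<in> carrier R" "q \<in> carrier R"
    using st sub(1) r q car by auto
  have "(s \<otimes> t) \<otimes> (r \<otimes> q) = (s \<otimes> r) \<otimes> (t \<otimes> q)" using c by (simp add: m_ac)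
  then show "r \<otimes> q \<in> local_ring"
    using denominator_mult[OF st(1,3)] sub(6)[OF st(2,4)] c by (auto simp: mem_local_ring intro!: bexI[of _ "s \<otimes> t"])
  have "(s \<otimes> t) \<otimes> (r \<oplus> q) = t \<otimes> (s \<otimes> r) \<oplus> s \<otimes> (t \<otimes> q)" using c by (simp add: r_distr m_ac)
  moreover have "t \<otimes> (s \<otimes> r) \<oplus> s \<otimes> (t \<otimes> q) \<in> A" using st sub(6,7) by blast
  ultimately show "r \<oplus> q \<in> local_ring"
    using denominator_mult[OF st(1,3)] c unfolding mem_local_ring by (intro conjI bexI[of _ "s \<otimes> t"]) auto
qed

lemma local_ring_subset_V: "local_ring \<subseteq> V"
proof
  fix r assume "r \<in> local_ring"
  then obtain s where s: "s \<in> A - center" "s \<otimes> r \<in> A" "r \<in> carrier R" by (auto simp: mem_local_ring)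
  obtain w where w: "w \<in> V" "s \<otimes> w = \<one>" using s(1) denominator_iff by blast
  have car: "s \<in> carrier R" "w \<in> carrier R" using s w AV nonunits_V(7) by auto
  have "w \<otimes> (s \<otimes> r) = (s \<otimes> w) \<otimes> r" using car s(3) by (simp add: m_ac)
  then have "w \<otimes> (s \<otimes> r) = r" using w s(3) by simp
  moreover have "w \<otimes> (s \<otimes> r) \<in> V" using w(1) s(2) AV subringE(6)[OF nonunits_V(1)] by blast
  ultimately show "r \<in> V" by simp
qed

lemma ideal_local_ideal: "ideal_pair R local_ring local_ideal"
  using nonunits_V subring_local_ring local_ring_subset_V subringE(2,6,7)[OF subring_local_ring]
  by (auto simp: ideal_pair_def local_ideal_def)

text \<open>Clear the denominator \<open>s\<close> of \<open>m\<close>: the element \<open>t = s (1 - m)\<close> lies in \<open>A\<close> and is invertible in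
  \<open>V\<close>, so it is an admissible denominator, and \<open>1/(1 - m) = s/t\<close>.\<close>

lemma one_minus_local_ideal_unit:
  assumes "m \<in> local_ideal"
  shows "\<exists>u \<in> local_ring. u \<otimes> (\<one> \<ominus> m) = \<one>"
proof -
  note sub = subringE[OF nonunits_V(1)]
  have m: "m \<in> local_ring" "m \<in> V" "m \<in> nonunits R V" "m \<in> carrier R"
    using assms local_ring_subset_V nonunits_V(7) by (auto simp: local_ideal_def)
  have dV: "\<one> \<ominus> m \<in> V" using sub(3,5,7) m(2) by (simp add: a_minus_def)
  have "\<one> \<ominus> m \<notin> nonunits R V"
  proof
    assume "\<one> \<ominus> m \<in> nonunits R V"
    then have "(\<one> \<ominus> m) \<oplus> m \<in> nonunits R V" using nonunits_V(4) m(3) by blast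
    moreover have "(\<one> \<ominus> m) \<oplus> m = \<one>" using m(4) by (simp add: a_minus_def a_assoc l_neg)
    ultimately show False using nonunits_ideal(2)[OF V] by simp
  qed
  then obtain u where u: "u \<in> V" "(\<one> \<ominus> m) \<otimes> u = \<one>" using dV by (auto simp: nonunits_def)
  obtain s where s: "s \<in> A - center" "s \<otimes> m \<in> A" using m(1) by (auto simp: mem_local_ring)
  obtain w where w: "w \<in> V" "s \<otimes> w = \<one>" using s(1) denominator_iff by blast
  define d t where "d = \<one> \<ominus> m" and "t = s \<otimes> d"
  have car: "s \<in> carrier R" "u \<in> carrier R" "w \<in> carrier R" "d \<in> carrier R"
    using s u w AV nonunits_V(7) m(4) by (auto simp: d_def)
  have "t = s \<ominus> s \<otimes> m"
    using car m(4) by (simp add: t_def d_def a_minus_def r_distr r_minus)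
  then have "t \<in> A" using s subringE(5,7)[OF A] by (simp add: a_minus_def)
  have "t \<otimes> (u \<otimes> w) = (d \<otimes> u) \<otimes> (s \<otimes> w)" using car by (simp add: t_def m_ac)
  then have "t \<otimes> (u \<otimes> w) = \<one>" using u w by (simp add: d_def)
  then have "t \<in> A - center" using \<open>t \<in> A\<close> u(1) w(1) sub(6) denominator_iff by blast
  moreover have "t \<otimes> u = s \<otimes> (d \<otimes> u)" using car by (simp add: t_def m_ac)
  then have "t \<otimes> u = s" using u car by (simp add: d_def)
  ultimately have "u \<in> local_ring" using s car unfolding mem_local_ring by auto
  moreover have "u \<otimes> (\<one> \<ominus> m) = \<one>" using u(2) car m(4) by (simp add: m_comm)
  ultimately show ?thesis by blast
qed

end

section \<open>Centers that determine the valuation ring\<close>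

locale unique_valuation_over_center = ring_below_valuation +
  assumes unique: "\<And>W. \<lbrakk>valuation_ring_of R W; A \<subseteq> W; center \<subseteq> nonunits R W\<rbrakk> \<Longrightarrow> W = V"
begin

text \<open>A valuation ring dominating a proper ideal \<open>J\<close> above the center can only be \<open>V\<close>, whose
  nonunits meet \<open>A\<close> in the center itself.\<close>

lemma maximalideal_center: "maximalideal center (R\<lparr>carrier := A\<rparr>)"
proof (rule maximalidealI)
  show "ideal center (R\<lparr>carrier := A\<rparr>)" using ideal_center ideal_pair_iff_ideal[OF A] by simp
  have "\<one> \<in> A - center" using subringE(3)[OF A] nonunits_ideal(2)[OF V] by (auto simp: center_def)
  then show "carrier (R\<lparr>carrier := A\<rparr>) \<noteq> center" by auto
  fix J assume J: "ideal J (R\<lparr>carrier := A\<rparr>)" "center \<subseteq> J" "J \<subseteq> carrier (R\<lparr>carrier := A\<rparr>)"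
  have pair: "ideal_pair R A J" using J(1) ideal_pair_iff_ideal[OF A] by simp
  show "J = center \<or> J = carrier (R\<lparr>carrier := A\<rparr>)"
  proof (cases "\<one> \<in> J")
    case True
    have "a \<in> J" if "a \<in> A" for a
      using ideal_pairD(5)[OF pair that True] that subringE(1)[OF A] by (simp add: subset_iff)
    then show ?thesis using J(3) by auto
  next
    case False
    then obtain W where "valuation_ring_of R W" "A \<subseteq> W" "J \<subseteq> nonunits R W"
      using exists_dominating_valuation_ring[OF pair] by blast
    moreover from this have "W = V" using unique J(2) by blast
    ultimately show ?thesis using J(2,3) by (auto simp: center_def)
  qed
qed

text \<open>With \<open>y = 1/x\<close> and \<open>L\<close> the local ring with its ideal \<open>N\<close>, a valuation ring dominating
  \<open>N + y L[y]\<close> would be \<open>V\<close>, in which \<open>y\<close> is not a nonunit, as its inverse \<open>x\<close> is in \<open>V\<close>. So \<open>1\<close> lies in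
  \<open>N + y L[y]\<close>, and the part in \<open>N\<close> can be removed because \<open>1 - m\<close> is a unit of \<open>L\<close> for \<open>m \<in> N\<close>.\<close>

lemma integral_over_localization:
  assumes "x \<in> V"
  shows "integral_over R local_ring x"
proof (cases "x = \<zero>")
  case True
  have "x [^] (1::nat) \<in> poly_values R local_ring x 1" using True by (simp add: poly_values.zero)
  then show ?thesis using integral_over_iff_power[OF subring_local_ring] True by blast
next
  case False
  have x: "x \<in> carrier R" using assms nonunits_V(7) by blast
  then obtain y where y: "y \<in> carrier R" "x \<otimes> y = \<one>"
    using False field_Units by (metis DiffI Units_inv_closed Units_r_inv singletonD)
  define B where "B = poly_extension R local_ring y"
  define I where "I = {m \<oplus> y \<otimes> b |m b. m \<in> local_ideal \<and> b \<in> B}"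
  have subB: "subring B R"
    using ideal_pairD(1)[OF poly_extension_ideal_pair[OF ideal_pair_self[OF subring_local_ring] y(1)]]
    by (simp add: B_def)
  note B = subringE[OF subB]
  note N = ideal_pairD[OF ideal_local_ideal]
  have LB: "local_ring \<subseteq> B" using poly_extension_base[OF N(7) y(1)] by (simp add: B_def)
  have yB: "y \<in> B" using poly_extension_generator[OF subring_local_ring y(1)] by (simp add: B_def)
  have Icar: "m \<in> carrier R" "b \<in> carrier R" if "m \<in> local_ideal" "b \<in> B" for m b
    using that N(6) B(1) by auto
  have "ideal_pair R B I"
    unfolding ideal_pair_def
  proof (intro conjI ballI)
    show "subring B R" by fact
    show "I \<subseteq> B" using LB yB N(2) B(6,7) unfolding I_def by blast
    show "\<zero> \<in> I" using N(3) B(2) y(1) unfolding I_def by force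
  next
    fix p q assume "p \<in> I" "q \<in> I"
    then obtain m b m' b' where mb: "m \<in> local_ideal" "b \<in> B" "p = m \<oplus> y \<otimes> b"
      "m' \<in> local_ideal" "b' \<in> B" "q = m' \<oplus> y \<otimes> b'" unfolding I_def by blast
    have "p \<oplus> q = (m \<oplus> m') \<oplus> y \<otimes> (b \<oplus> b')"
      using mb Icar y(1) by (simp add: r_distr a_ac)
    then show "p \<oplus> q \<in> I" using mb N(4) B(7) unfolding I_def by blast
  next
    fix c p assume c: "c \<in> B" and "p \<in> I"
    then obtain m b where mb: "m \<in> local_ideal" "b \<in> B" "p = m \<oplus> y \<otimes> b" unfolding I_def by blast
    \<comment> \<open>The constant term of \<open>c\<close> keeps \<open>m\<close> in \<open>N\<close>; the rest of \<open>c\<close> has a factor \<open>y\<close>.\<close>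
    obtain n where "c \<in> poly_values R local_ring y n" using c by (auto simp: B_def poly_extension_def)
    then have "c \<in> poly_values R local_ring y (Suc n)" by (rule poly_values_mono) auto
    then obtain r b' where rb: "r \<in> local_ring" "b' \<in> poly_values R local_ring y n" "c = r \<oplus> y \<otimes> b'"
      using poly_values_bottom[OF ideal_pair_self[OF subring_local_ring] y(1)] by blast
    then have b'B: "b' \<in> B" by (auto simp: B_def poly_extension_def)
    have car: "r \<in> carrier R" "b' \<in> carrier R" "m \<in> carrier R" "b \<in> carrier R" "c \<in> carrier R"
      using rb(1) N(7) b'B B(1) mb Icar c by auto
    have "c \<otimes> p = c \<otimes> m \<oplus> y \<otimes> (c \<otimes> b)"
      using mb(3) car y(1) by (simp add: r_distr m_ac)
    also have "c \<otimes> m = r \<otimes> m \<oplus> y \<otimes> (b' \<otimes> m)"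
      using rb(3) car y(1) by (simp add: l_distr r_distr m_ac)
    finally have "c \<otimes> p = r \<otimes> m \<oplus> y \<otimes> (b' \<otimes> m \<oplus> c \<otimes> b)"
      using car y(1) by (simp add: r_distr a_ac)
    moreover have "r \<otimes> m \<in> local_ideal" using N(5) rb(1) mb(1) by blast
    moreover have "b' \<otimes> m \<oplus> c \<otimes> b \<in> B"
      using B(7)[OF B(6)[OF b'B subsetD[OF LB subsetD[OF N(2) mb(1)]]] B(6)[OF c mb(2)]] .
    ultimately show "c \<otimes> p \<in> I" unfolding I_def by blast
  qed
  moreover have NI: "local_ideal \<subseteq> I"
  proof
    fix m assume m: "m \<in> local_ideal"
    then have "m = m \<oplus> y \<otimes> \<zero>" using N(6) y(1) by (simp add: subset_iff)
    then show "m \<in> I" using m B(2) unfolding I_def by blast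
  qed
  moreover have yI: "y \<in> I"
  proof -
    have "y = \<zero> \<oplus> y \<otimes> \<one>" using y(1) by simp
    then show ?thesis using N(3) B(3) unfolding I_def by blast
  qed
  moreover have "\<one> \<in> I"
  proof (rule ccontr)
    assume "\<one> \<notin> I"
    then obtain W where W: "valuation_ring_of R W" "B \<subseteq> W" "I \<subseteq> nonunits R W"
      using exists_dominating_valuation_ring[OF \<open>ideal_pair R B I\<close>] by blast
    have "center \<subseteq> local_ideal" using A_subset_local_ring by (auto simp: center_def local_ideal_def)
    then have "W = V" using unique[OF W(1)] W A_subset_local_ring LB NI by blast
    then have "y \<otimes> x \<noteq> \<one>" using yI W(3) assms by (auto simp: nonunits_def)
    then show False using y x by (simp add: m_comm)
  qed
  then obtain m b where mb: "m \<in> local_ideal" "b \<in> B" "\<one> = m \<oplus> y \<otimes> b" unfolding I_def by blast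
  obtain n where bn: "b \<in> poly_values R local_ring y n" using mb(2) by (auto simp: B_def poly_extension_def)
  obtain u where u: "u \<in> local_ring" "u \<otimes> (\<one> \<ominus> m) = \<one>" using one_minus_local_ideal_unit[OF mb(1)] by blast
  have car: "m \<in> carrier R" "b \<in> carrier R" "u \<in> carrier R" using Icar mb(1,2) u(1) N(7) by auto
  have "(m \<oplus> y \<otimes> b) \<ominus> m = y \<otimes> b" using car y(1) by (simp add: a_minus_def a_ac r_neg2)
  then have "u \<otimes> (y \<otimes> b) = \<one>" using u(2) mb(3) by simp
  then have "y \<otimes> (u \<otimes> b) = \<one>" using car y(1) by (simp add: m_ac)
  moreover have "u \<otimes> b \<in> poly_values R local_ring y n"
    using poly_values_smult[OF ideal_pair_self[OF subring_local_ring] y(1) u(1) bn] .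
  ultimately show ?thesis
    using integral_over_of_one_in_inverse_span[OF subring_local_ring x y] by blast
qed

lemma valuation_ring_eq_integral_closure: "V = integral_closure R local_ring"
  using integral_over_localization nonunits_V(7)
    valuation_ring_integrally_closed[OF V subring_local_ring local_ring_subset_V]
  by (auto simp: integral_closure_def)

end

section \<open>Compactness\<close>

text \<open>The finite set singles out \<open>V\<close> among the valuation overrings: \<open>V\<close> avoids it and all others
  meet it. Minimality enters to produce, for \<open>W \<noteq> V\<close>, an element of \<open>W\<close> outside \<open>V\<close>.\<close>

lemma finite_test_set_if_punctured_Zar_compact:
  assumes min: "minimal_valuation_overring K D V"
    and compact: "compactin (zariski_topology K D) (Zar K D - {V})"
  shows "\<exists>T. finite T \<and> T \<subseteq> carrier K - V \<and> (\<forall>W \<in> Zar K D. W \<noteq> V \<longrightarrow> T \<inter> W \<noteq> {})"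
proof -
  define U where "U x = {W \<in> Zar K D. {x} \<subseteq> W}" for x
  have "openin (zariski_topology K D) (U x)" if "x \<in> carrier K - V" for x
    unfolding zariski_topology_def U_def
    by (rule topology_generated_by_Basis) (use that in blast)
  moreover have "Zar K D - {V} \<subseteq> \<Union>(U ` (carrier K - V))"
  proof
    fix W assume W: "W \<in> Zar K D - {V}"
    then have "\<not> W \<subseteq> V" using min unfolding minimal_valuation_overring_def by blast
    moreover have "W \<subseteq> carrier K"
      using W subringE(1) unfolding Zar_def valuation_ring_of_def subdomain_def subcring_def by blast
    ultimately show "W \<in> \<Union>(U ` (carrier K - V))" using W by (auto simp: U_def)
  qed
  ultimately obtain F where F: "finite F" "F \<subseteq> U ` (carrier K - V)" "Zar K D - {V} \<subseteq> \<Union>F"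
    using compact unfolding compactin_def by (metis (no_types, lifting) imageE)
  obtain T where T: "finite T" "T \<subseteq> carrier K - V" "F = U ` T"
    using finite_subset_image[OF F(1,2)] by blast
  then have "\<forall>W \<in> Zar K D. W \<noteq> V \<longrightarrow> T \<inter> W \<noteq> {}"
    using F(3) by (auto simp: U_def)
  then show ?thesis using T by blast
qed

theorem theorem3p6:
  fixes K :: "('a, 'b) ring_scheme" and D V :: "'a set"
  assumes "field K"
    and "subdomain D K"
    and "has_quotient_field K D"
    and "minimal_valuation_overring K D V"
    and "compactin (zariski_topology K D) (Zar K D - {V})"
  shows "\<exists>S M. finite S \<and> S \<subseteq> carrier K
           \<and> maximalideal M (K\<lparr>carrier := adjoin K D S\<rparr>)
           \<and> V = integral_closure K (localization_at K (adjoin K D S) M)"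
proof -
  interpret K: field K by fact
  have VZ: "D \<subseteq> V" "valuation_ring_of K V"
    using assms(4) by (auto simp: minimal_valuation_overring_def Zar_def)
  note V = K.valuation_ring_ofD[OF VZ(2)]
  obtain T where T: "finite T" "T \<subseteq> carrier K - V"
    and test: "\<forall>W \<in> Zar K D. W \<noteq> V \<longrightarrow> T \<inter> W \<noteq> {}"
    using finite_test_set_if_punctured_Zar_compact[OF assms(4,5)] by auto
  define S where "S = m_inv K ` T"
  define A where "A = adjoin K D S"
  have unit: "x \<in> Units K" if "x \<in> T" for x
    using that T(2) subringE(2)[OF V(1)] K.field_Units by blast
  have Snon: "S \<subseteq> nonunits K V"
  proof
    fix y assume "y \<in> S"
    then obtain x where x: "x \<in> T" "y = inv\<^bsub>K\<^esub> x" by (auto simp: S_def)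
    have xV: "x \<in> carrier K" "x \<notin> V" using x T(2) by auto
    have y: "y \<in> carrier K" "x \<otimes>\<^bsub>K\<^esub> y = \<one>\<^bsub>K\<^esub>" using x unit by auto
    have "y \<in> V" using V(3)[OF xV(1) y] xV(2) by blast
    moreover have "y \<otimes>\<^bsub>K\<^esub> w \<noteq> \<one>\<^bsub>K\<^esub>" if "w \<in> V" for w
    proof
      assume "y \<otimes>\<^bsub>K\<^esub> w = \<one>\<^bsub>K\<^esub>"
      moreover have "w \<in> carrier K" using that V(2) by blast
      ultimately have "(x \<otimes>\<^bsub>K\<^esub> y) \<otimes>\<^bsub>K\<^esub> w = x"
        using y(1) xV(1) by (simp add: K.m_assoc)
      then have "w = x" using y(2) \<open>w \<in> carrier K\<close> by simp
      then show False using that xV(2) by simp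
    qed
    ultimately show "y \<in> nonunits K V" by (simp add: nonunits_def)
  qed
  have SV: "S \<subseteq> V" using Snon by (auto simp: nonunits_def)
  have DS: "D \<union> S \<subseteq> carrier K" using VZ(1) SV V(2) by blast
  have A: "subring A K" "D \<union> S \<subseteq> A" "A \<subseteq> V"
    using K.generate_ringE[OF DS refl] V(1) VZ(1) SV by (auto simp: A_def adjoin_def)
  interpret B: ring_below_valuation K A V
    by (intro ring_below_valuation.intro ring_below_valuation_axioms.intro
        assms(1) A(1,3) VZ(2))
  interpret U: unique_valuation_over_center K A V
  proof
    fix W assume W: "valuation_ring_of K W" "A \<subseteq> W" "B.center \<subseteq> nonunits K W"
    show "W = V"
    proof (rule ccontr)
      assume "W \<noteq> V"
      moreover have "W \<in> Zar K D" using W A(2) by (auto simp: Zar_def)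
      ultimately obtain x where x: "x \<in> T" "x \<in> W" using test by blast
      have "inv\<^bsub>K\<^esub> x \<in> B.center" using x(1) Snon A(2) by (auto simp: B.center_def S_def)
      then have "inv\<^bsub>K\<^esub> x \<otimes>\<^bsub>K\<^esub> x \<noteq> \<one>\<^bsub>K\<^esub>" using W(3) x(2) by (auto simp: nonunits_def)
      then show False using unit[OF x(1)] by simp
    qed
  qed
  show ?thesis
  proof (intro exI conjI)
    show "finite S" using T(1) by (simp add: S_def)
    show "S \<subseteq> carrier K" using DS by blast
    show "maximalideal B.center (K\<lparr>carrier := adjoin K D S\<rparr>)"
      using U.maximalideal_center by (simp add: A_def)
    show "V = integral_closure K (localization_at K (adjoin K D S) B.center)"
      using U.valuation_ring_eq_integral_closure unfolding A_def[symmetric] B.local_ring_def .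
  qed
qed

end
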